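(* Let $G$ be a graph of order $n$ with vertex set $V(G)=\{v_1,\dots,v_n\}$ and minimum degree $\delta$, and let $\mathbf{r}=(r_1,\dots,r_n)$ and $\mathbf{s}=(s_1,\dots,s_n)$ be $n$-tuples of nonnegative integers. Put $\tau=\min\{r_1,\dots,r_n\}$ and $s=\max\{s_1,\dots,s_n\}$. Let $c>1$ be a constant. If $(\delta+1)\tau\ge cs$, then $$\gamma\langle\mathbf{r},\mathbf{s}\rangle(G)<\left(\frac{c}{\delta+1}+\frac{1}{e^{0.5s(c+1/c-2)}}\right)sn .$$
   Context: All graphs are finite, undirected, without loops and multiple edges. $N[v]$ denotes the closed neighbourhood of $v$ (the neighbours of $v$ together with $v$). Let $\mathbf{N}$ denote the set of nonnegative integers. A function $f:V(G)\to\mathbf{N}$ is an $\mathbf{r}$-function of $G$ if $f(v_i)\le r_i$ for all $i=1,\dots,n$. An $\mathbf{r}$-function $f$ is $\mathbf{s}$-dominating if $\sum_{u\in N[v_i]}f(u)\ge s_i$ for all $i=1,\dots,n$. The weight of $f$ is $|f|=\sum_{i=1}^n f(v_i)$. The $\langle\mathbf{r},\mathbf{s}\rangle$-domination number $\gamma\langle\mathbf{r},\mathbf{s}\rangle(G)$ is the smallest weight of an $\mathbf{s}$-dominating $\mathbf{r}$-function of $G$ (such functions exist if and only if $\sum_{v_j\in N[v_i]}r_j\ge s_i$ for all $i=1,\dots,n$).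
   Formalization: The formal theorem assumes s > 0, that is, some s_i is positive; for s = 0 the zero function gives domination number 0 and the right-hand side is also 0, so the strict inequality fails. *)

theory Defs
  imports Complex_Main "Graph_Theory.Digraph"
begin

text \<open>
  The locale \<^locale>\<open>graph\<close> describes finite simple undirected graphs, an edge being a pair of
  opposite arcs. Hence the degree of a vertex is its \<^const>\<open>out_degree\<close>.
\<close>

definition closed_nbhd :: "('a, 'b) pre_digraph \<Rightarrow> 'a \<Rightarrow> 'a set" where
  "closed_nbhd G v = insert v {u. v \<rightarrow>\<^bsub>G\<^esub> u}"

definition min_degree :: "('a, 'b) pre_digraph \<Rightarrow> nat" where
  "min_degree G = Min (out_degree G ` verts G)"

text \<open>
  Tuples indexed by the vertices are functions on the vertex type; only their values on
  \<^term>\<open>verts G\<close> matter.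
\<close>

definition r_function :: "('a, 'b) pre_digraph \<Rightarrow> ('a \<Rightarrow> nat) \<Rightarrow> ('a \<Rightarrow> nat) \<Rightarrow> bool" where
  "r_function G r f \<longleftrightarrow> (\<forall>v\<in>verts G. f v \<le> r v)"

definition s_dominating :: "('a, 'b) pre_digraph \<Rightarrow> ('a \<Rightarrow> nat) \<Rightarrow> ('a \<Rightarrow> nat) \<Rightarrow> bool" where
  "s_dominating G s f \<longleftrightarrow> (\<forall>v\<in>verts G. (\<Sum>u\<in>closed_nbhd G v. f u) \<ge> s v)"

definition weight :: "('a, 'b) pre_digraph \<Rightarrow> ('a \<Rightarrow> nat) \<Rightarrow> nat" where
  "weight G f = (\<Sum>v\<in>verts G. f v)"

text \<open>Meaningful only if some \<open>s\<close>-dominating \<open>r\<close>-function exists.\<close>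

definition rs_domination_number ::
    "('a, 'b) pre_digraph \<Rightarrow> ('a \<Rightarrow> nat) \<Rightarrow> ('a \<Rightarrow> nat) \<Rightarrow> nat" where
  "rs_domination_number G r s =
     (LEAST w. \<exists>f. r_function G r f \<and> s_dominating G s f \<and> weight G f = w)"

lemma (in graph) closed_nbhd_subset: "v \<in> verts G \<Longrightarrow> closed_nbhd G v \<subseteq> verts G"
  by (auto simp: closed_nbhd_def arcs_ends_conv)

lemma (in graph) card_closed_nbhd:
  assumes "v \<in> verts G"
  shows "card (closed_nbhd G v) = out_degree G v + 1"
proof -
  have eq: "{u. v \<rightarrow>\<^bsub>G\<^esub> u} = head G ` out_arcs G v"
    by (auto simp: arcs_ends_conv out_arcs_def)
  have "inj_on (head G) (out_arcs G v)"
    by (rule inj_onI) (auto simp: out_arcs_def arc_to_ends_def intro: no_multi_arcs)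
  then have "card {u. v \<rightarrow>\<^bsub>G\<^esub> u} = out_degree G v"
    by (simp add: eq card_image out_degree_def)
  moreover have "finite {u. v \<rightarrow>\<^bsub>G\<^esub> u}"
    by (simp add: eq out_arcs_def)
  moreover have "v \<notin> {u. v \<rightarrow>\<^bsub>G\<^esub> u}"
    using adj_not_same by blast
  ultimately show ?thesis
    by (simp add: closed_nbhd_def)
qed

lemma (in graph) s_dominating_r_function_exists_iff:
  "(\<exists>f. r_function G r f \<and> s_dominating G s f) \<longleftrightarrow>
   (\<forall>v\<in>verts G. (\<Sum>u\<in>closed_nbhd G v. r u) \<ge> s v)"
proof
  assume "\<exists>f. r_function G r f \<and> s_dominating G s f"
  then obtain f where f: "r_function G r f" "s_dominating G s f" by blast
  show "\<forall>v\<in>verts G. (\<Sum>u\<in>closed_nbhd G v. r u) \<ge> s v"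
  proof
    fix v assume v: "v \<in> verts G"
    have "s v \<le> (\<Sum>u\<in>closed_nbhd G v. f u)"
      using f(2) v by (simp add: s_dominating_def)
    also have "\<dots> \<le> (\<Sum>u\<in>closed_nbhd G v. r u)"
      using f(1) closed_nbhd_subset[OF v] by (intro sum_mono) (auto simp: r_function_def)
    finally show "s v \<le> (\<Sum>u\<in>closed_nbhd G v. r u)" .
  qed
next
  assume "\<forall>v\<in>verts G. (\<Sum>u\<in>closed_nbhd G v. r u) \<ge> s v"
  then show "\<exists>f. r_function G r f \<and> s_dominating G s f"
    by (intro exI[of _ r]) (simp add: r_function_def s_dominating_def)
qed

end

theory Submission
  imports Defs
begin

text \<open>
  The bound comes from randomized rounding followed by a greedy repair. The constant function
  \<open>y = c * smax / (\<delta> + 1)\<close> is at most every \<open>r v\<close>, and it gives each closed neighbourhood, which has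
  at least \<open>\<delta> + 1\<close> elements, a total of at least \<open>c * smax\<close>. Rounding \<open>y\<close> at each vertex
  independently to one of two neighbouring integers, without changing the mean, produces an
  \<open>r\<close>-function \<open>f\<close> of expected weight \<open>n * y\<close>. Where \<open>f\<close> falls short of the demand of a vertex, its
  values are raised within the closed neighbourhood; the additional weight is at most the sum of all
  shortfalls (\<open>rs_domination_number_le_weight_plus_deficits\<close>).

  If \<open>X\<close> is the total of \<open>f\<close> on a closed neighbourhood, then, with \<open>q = 1 / c\<close>, the shortfall is
  strictly less than \<open>smax * q ^ X / q ^ smax\<close> (\<open>deficit_less_power\<close>). As \<open>X\<close> is a sum of
  independent variables with mean at least \<open>c * smax\<close>, the expectation of \<open>q ^ X\<close> is at most
  \<open>exp (- (1 - q) * c * smax)\<close> (\<open>rounded_power_le_exp\<close>). Hence the expected shortfall is less than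
  \<open>smax * exp (- smax * (c - 1 - ln c))\<close>, and \<open>ln c \<le> (c - 1 / c) / 2\<close> turns the exponent into the one
  required.

  The expectation of this upper bound on the final weight is a multilinear function of the rounding
  probabilities. So no probability space is needed: such a function does not increase when a suitable
  choice of \<open>0\<close> or \<open>1\<close> replaces the coordinates one at a time (\<open>multilinear_rounding\<close>).
\<close>

section \<open>Greedy repair\<close>

text \<open>
  Raising one value by one at a time never overshoots the target \<open>t\<close>, so the total increase is
  exactly the deficit; as long as the target is missed, some value is still below its cap.
\<close>

lemma raise_sum_to_target:
  fixes f r :: "'a \<Rightarrow> nat"
  assumes "finite A" "t \<le> (\<Sum>u\<in>A. r u)" "\<And>u. u \<in> A \<Longrightarrow> f u \<le> r u"
  shows "\<exists>g. (\<forall>u. f u \<le> g u) \<and> (\<forall>u\<in>A. g u \<le> r u) \<and> (\<forall>u. u \<notin> A \<longrightarrow> g u = f u) \<and>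
    t \<le> (\<Sum>u\<in>A. g u) \<and> (\<Sum>u\<in>A. g u) = (\<Sum>u\<in>A. f u) + (t - (\<Sum>u\<in>A. f u))"
  using assms
proof (induction "t - (\<Sum>u\<in>A. f u)" arbitrary: f)
  case 0
  then show ?case by (intro exI[of _ f]) auto
next
  case (Suc d)
  have "\<exists>a\<in>A. f a < r a"
  proof (rule ccontr)
    assume "\<not> (\<exists>a\<in>A. f a < r a)"
    then have "(\<Sum>u\<in>A. r u) \<le> (\<Sum>u\<in>A. f u)"
      by (intro sum_mono) (auto simp: not_less)
    with Suc.hyps(2) Suc.prems(2) show False by linarith
  qed
  then obtain a where a: "a \<in> A" "f a < r a" by blast
  define h where "h = f(a := f a + 1)"
  have sum_h: "(\<Sum>u\<in>A. h u) = (\<Sum>u\<in>A. f u) + 1"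
    using a(1) Suc.prems(1) by (simp add: h_def sum.remove[where x = a])
  have "d = t - (\<Sum>u\<in>A. h u)"
    using Suc.hyps(2) sum_h by linarith
  moreover have "h u \<le> r u" if "u \<in> A" for u
    using Suc.prems(3) a that by (auto simp: h_def)
  ultimately obtain g where g: "\<forall>u. h u \<le> g u" "\<forall>u\<in>A. g u \<le> r u" "\<forall>u. u \<notin> A \<longrightarrow> g u = h u"
      "t \<le> (\<Sum>u\<in>A. g u)" "(\<Sum>u\<in>A. g u) = (\<Sum>u\<in>A. h u) + (t - (\<Sum>u\<in>A. h u))"
    using Suc.hyps(1)[of h] Suc.prems(1,2) by blast
  have "f u \<le> g u" for u
    using g(1)[rule_format, of u] by (auto simp: h_def split: if_splits)
  moreover have "(\<Sum>u\<in>A. g u) = (\<Sum>u\<in>A. f u) + (t - (\<Sum>u\<in>A. f u))"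
    using g(5) sum_h Suc.hyps(2) by linarith
  ultimately show ?case
    using g a(1) by (intro exI[of _ g]) (auto simp: h_def)
qed

text \<open>
  The vertices are repaired one after the other. Since values only increase, a repaired vertex stays
  satisfied, and the deficit met at a vertex is at most the one it had under the initial \<open>f\<close>.
\<close>

lemma (in graph) rs_domination_number_le_weight_plus_deficits:
  assumes feasible: "\<And>v. v \<in> verts G \<Longrightarrow> s v \<le> (\<Sum>u\<in>closed_nbhd G v. r u)"
    and f: "r_function G r f"
  shows "rs_domination_number G r s
    \<le> weight G f + (\<Sum>v\<in>verts G. s v - (\<Sum>u\<in>closed_nbhd G v. f u))"
proof -
  have "\<exists>g. (\<forall>u. f u \<le> g u) \<and> r_function G r g \<and> (\<forall>v\<in>W. s v \<le> (\<Sum>u\<in>closed_nbhd G v. g u)) \<and>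
      weight G g \<le> weight G f + (\<Sum>v\<in>W. s v - (\<Sum>u\<in>closed_nbhd G v. f u))"
    if "finite W" "W \<subseteq> verts G" for W
    using that
  proof (induction W rule: finite_induct)
    case empty
    then show ?case using f by (intro exI[of _ f]) auto
  next
    case (insert w W)
    let ?N = "closed_nbhd G"
    from insert obtain g where g: "\<forall>u. f u \<le> g u" "r_function G r g"
        "\<forall>v\<in>W. s v \<le> (\<Sum>u\<in>?N v. g u)"
        "weight G g \<le> weight G f + (\<Sum>v\<in>W. s v - (\<Sum>u\<in>?N v. f u))"
      by auto
    have w: "w \<in> verts G" using insert.prems by simp
    have sub: "?N w \<subseteq> verts G" using closed_nbhd_subset[OF w] .
    then have fin: "finite (?N w)" using finite_verts finite_subset by blast
    have "g u \<le> r u" if "u \<in> ?N w" for u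
      using g(2) sub that by (auto simp: r_function_def)
    from raise_sum_to_target[OF fin feasible[OF w] this]
    obtain h where h: "\<forall>u. g u \<le> h u" "\<forall>u\<in>?N w. h u \<le> r u" "\<forall>u. u \<notin> ?N w \<longrightarrow> h u = g u"
        "s w \<le> (\<Sum>u\<in>?N w. h u)" "(\<Sum>u\<in>?N w. h u) = (\<Sum>u\<in>?N w. g u) + (s w - (\<Sum>u\<in>?N w. g u))"
      by blast
    have "\<forall>v\<in>insert w W. s v \<le> (\<Sum>u\<in>?N v. h u)"
      using h(1,4) g(3) by (auto intro!: order_trans[OF _ sum_mono[of _ g h]])
    moreover have "r_function G r h"
      using g(2) h(2,3) unfolding r_function_def by metis
    moreover have "weight G h \<le> weight G f + (\<Sum>v\<in>insert w W. s v - (\<Sum>u\<in>?N v. f u))"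
    proof -
      have split: "weight G k = (\<Sum>u\<in>?N w. k u) + (\<Sum>u\<in>verts G - ?N w. k u)" for k
        unfolding weight_def using sum.subset_diff[OF sub finite_verts, of k] by simp
      have "(\<Sum>u\<in>verts G - ?N w. h u) = (\<Sum>u\<in>verts G - ?N w. g u)"
        using h(3) by (intro sum.cong) auto
      then have "weight G h = weight G g + (s w - (\<Sum>u\<in>?N w. g u))"
        using h(5) split[of h] split[of g] by linarith
      moreover have "(\<Sum>u\<in>?N w. f u) \<le> (\<Sum>u\<in>?N w. g u)"
        using g(1) by (intro sum_mono) auto
      moreover have "(\<Sum>v\<in>insert w W. s v - (\<Sum>u\<in>?N v. f u))
          = (s w - (\<Sum>u\<in>?N w. f u)) + (\<Sum>v\<in>W. s v - (\<Sum>u\<in>?N v. f u))"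
        using insert.hyps by simp
      ultimately show ?thesis using g(4) by linarith
    qed
    moreover have "\<forall>u. f u \<le> h u"
      using g(1) h(1) order_trans by blast
    ultimately show ?case by (intro exI[of _ h]) blast
  qed
  from this[OF finite_verts subset_refl]
  obtain g where g: "r_function G r g" "s_dominating G s g"
      "weight G g \<le> weight G f + (\<Sum>v\<in>verts G. s v - (\<Sum>u\<in>closed_nbhd G v. f u))"
    unfolding s_dominating_def by blast
  have "rs_domination_number G r s \<le> weight G g"
    unfolding rs_domination_number_def by (rule Least_le) (use g in blast)
  with g(3) show ?thesis by linarith
qed

section \<open>Rounding\<close>

text \<open>
  In each coordinate the value at a point of \<open>[0, 1]\<close> is a weighted mean of the values at the end
  points, so moving to the better end point does not increase \<open>F\<close>.
\<close>

lemma multilinear_rounding: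
  fixes F :: "('i \<Rightarrow> real) \<Rightarrow> real"
  assumes "finite I"
    and affine: "\<And>x i t. i \<in> I \<Longrightarrow> F (x(i := t)) = (1 - t) * F (x(i := 0)) + t * F (x(i := 1))"
    and unit: "\<And>i. i \<in> I \<Longrightarrow> 0 \<le> x i \<and> x i \<le> 1"
  obtains y where "\<And>i. i \<in> I \<Longrightarrow> y i = 0 \<or> y i = 1" "F y \<le> F x"
proof -
  have "\<exists>y. (\<forall>i\<in>I. y i = 0 \<or> y i = 1) \<and> (\<forall>i. i \<notin> I \<longrightarrow> y i = x i) \<and> F y \<le> F x"
    using assms
  proof (induction I rule: finite_induct)
    case empty
    then show ?case by auto
  next
    case (insert i I)
    obtain y where y: "\<forall>j\<in>I. y j = 0 \<or> y j = 1" "\<forall>j. j \<notin> I \<longrightarrow> y j = x j" "F y \<le> F x"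
      using insert.IH[OF insert.prems(1)[OF insertI2] insert.prems(2)[OF insertI2]] by blast
    have t: "0 \<le> y i" "y i \<le> 1"
      using insert.hyps(2) insert.prems(2)[of i] y(2) by auto
    have mean: "F y = (1 - y i) * F (y(i := 0)) + y i * F (y(i := 1))"
      using insert.prems(1)[of i y "y i"] by (simp only: insertI1 fun_upd_triv)
    have "\<exists>b. (b = 0 \<or> b = 1) \<and> F (y(i := b)) \<le> F y"
    proof (rule ccontr)
      assume "\<not> ?thesis"
      then have "F y < F (y(i := 0))" "F y < F (y(i := 1))" by (auto simp: not_le)
      with t have "(1 - y i) * F y + y i * F y < (1 - y i) * F (y(i := 0)) + y i * F (y(i := 1))"
        by (cases "y i = 0")
          (auto intro!: add_le_less_mono mult_left_mono mult_strict_left_mono)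
      with mean show False by (simp add: algebra_simps)
    qed
    then obtain b where b: "b = 0 \<or> b = 1" "F (y(i := b)) \<le> F y" by blast
    have "F (y(i := b)) \<le> F x" using b(2) y(3) by (rule order_trans)
    with y(1,2) b(1) show ?case by (intro exI[of _ "y(i := b)"]) (simp del: fun_upd_apply, simp)
  qed
  then show thesis using that by blast
qed

lemma prod_affine_coordinate:
  fixes x :: "'i \<Rightarrow> real"
  assumes "finite A"
  shows "(\<Prod>u\<in>A. a + b * (x(i := t)) u)
    = (1 - t) * (\<Prod>u\<in>A. a + b * (x(i := 0)) u) + t * (\<Prod>u\<in>A. a + b * (x(i := 1)) u)"
proof (cases "i \<in> A")
  case True
  have "(\<Prod>u\<in>A. a + b * (x(i := z)) u) = (a + b * z) * (\<Prod>u\<in>A - {i}. a + b * x u)" for z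
    using prod.remove[OF assms True, of "\<lambda>u. a + b * (x(i := z)) u"] by simp
  then show ?thesis by (simp add: algebra_simps)
next
  case False
  then have "(\<Prod>u\<in>A. a + b * (x(i := z)) u) = (\<Prod>u\<in>A. a + b * x u)" for z
    by (intro prod.cong) auto
  then show ?thesis by (simp add: algebra_simps)
qed

lemma sum_affine_coordinate:
  fixes x :: "'i \<Rightarrow> real"
  assumes "finite A"
  shows "(\<Sum>u\<in>A. a + (x(i := t)) u)
    = (1 - t) * (\<Sum>u\<in>A. a + (x(i := 0)) u) + t * (\<Sum>u\<in>A. a + (x(i := 1)) u)"
  unfolding sum_distrib_left sum.distrib[symmetric]
  by (intro sum.cong) (auto simp: algebra_simps)

section \<open>Exponential estimates\<close>

text \<open>
  A Chernoff-type majorant of the deficit. It is strict even for \<open>x = 0\<close>, where the deficit is all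
  of \<open>k\<close>; this makes the final inequality strict.
\<close>

lemma deficit_less_power:
  fixes q :: real
  assumes "0 < q" "q < 1" "0 < k"
  shows "real (k - x) < real k / q ^ k * q ^ x"
proof (cases "x < k")
  case True
  then have "q ^ k < q ^ x" using assms by (simp add: power_strict_decreasing)
  then have "1 < q ^ x / q ^ k" using assms by simp
  then have "real k * 1 < real k * (q ^ x / q ^ k)"
    using assms by (intro mult_strict_left_mono) auto
  moreover have "real (k - x) \<le> real k" by simp
  ultimately show ?thesis by simp
next
  case False
  then show ?thesis using assms by simp
qed

text \<open>
  The left-hand side is the expectation of \<open>q ^ Z\<close> when \<open>Z\<close> takes the values \<open>m + 1\<close> and \<open>m\<close> with
  probabilities \<open>\<theta>\<close> and \<open>1 - \<theta>\<close>, and \<open>m + \<theta>\<close> is the mean of \<open>Z\<close>.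
\<close>

lemma rounded_power_le_exp:
  fixes q \<theta> :: real
  assumes "0 \<le> q"
  shows "q ^ m * (1 - (1 - q) * \<theta>) \<le> exp (- (1 - q) * (real m + \<theta>))"
proof -
  have "q \<le> exp (- (1 - q))" using exp_ge_add_one_self[of "- (1 - q)"] by simp
  then have "q ^ m \<le> exp (- (1 - q)) ^ m" using assms by (rule power_mono)
  moreover have "1 - (1 - q) * \<theta> \<le> exp (- (1 - q) * \<theta>)"
    using exp_ge_add_one_self[of "- (1 - q) * \<theta>"] by linarith
  ultimately have "q ^ m * (1 - (1 - q) * \<theta>) \<le> exp (- (1 - q)) ^ m * exp (- (1 - q) * \<theta>)"
    using assms
    by (intro order_trans[OF mult_left_mono mult_right_mono]) auto
  also have "\<dots> = exp (- (1 - q) * (real m + \<theta>))"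
    unfolding exp_of_nat_mult[symmetric] exp_add[symmetric] by (simp add: algebra_simps)
  finally show ?thesis .
qed

text \<open>With \<open>c = exp t\<close> this is the inequality \<open>t \<le> sinh t\<close>.\<close>

lemma power_times_exp_le:
  fixes c :: real
  assumes "1 < c"
  shows "c ^ k * exp (- real k * (c - 1)) \<le> 1 / exp (1 / 2 * real k * (c + 1 / c - 2))"
proof -
  have "ln c \<le> (c - 1 / c) / 2"
    using real_le_x_sinh[of "ln c"] assms by (simp add: inverse_eq_divide)
  then have "real k * ln c \<le> real k * ((c - 1 / c) / 2)"
    by (intro mult_left_mono) auto
  then have "real k * ln c - real k * (c - 1) \<le> - (1 / 2 * real k * (c + 1 / c - 2))"
    by (simp add: field_simps)
  moreover have "c ^ k = exp (real k * ln c)"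
    using assms by (simp add: exp_of_nat_mult)
  moreover have "1 / exp z = exp (- z)" for z :: real
    by (simp add: exp_minus inverse_eq_divide)
  ultimately show ?thesis
    by (simp only: exp_add[symmetric] exp_le_cancel_iff)
qed

section \<open>The upper bound\<close>

theorem theorem10:
  fixes G :: "('a, 'b) pre_digraph"
    and r s :: "'a \<Rightarrow> nat"
    and n \<delta> \<tau> smax :: nat
    and c :: real
  assumes "graph G"
    and "verts G \<noteq> {}"
    and "n = card (verts G)"
    and "\<delta> = min_degree G"
    and "\<tau> = Min (r ` verts G)"
    and "smax = Max (s ` verts G)"
    and "smax > 0"
    and "c > 1"
    and "(real \<delta> + 1) * real \<tau> \<ge> c * real smax"
  shows "real (rs_domination_number G r s)
    < (c / (real \<delta> + 1) + 1 / exp (1 / 2 * real smax * (c + 1 / c - 2))) * real smax * real n"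
proof -
  interpret graph G by fact
  let ?V = "verts G" and ?N = "closed_nbhd G"
  have fin: "finite ?V" by simp
  have finN: "finite (?N v)" if "v \<in> ?V" for v
    using closed_nbhd_subset[OF that] finite_subset fin by blast
  have \<tau>: "\<tau> \<le> r v" if "v \<in> ?V" for v
    using that fin assms(5) by simp
  have smax: "s v \<le> smax" if "v \<in> ?V" for v
    using that fin assms(6) by simp
  have card_N: "\<delta> + 1 \<le> card (?N v)" if "v \<in> ?V" for v
    using card_closed_nbhd[OF that] that fin assms(4) by (simp add: min_degree_def)

  have feasible: "s v \<le> (\<Sum>u\<in>?N v. r u)" if v: "v \<in> ?V" for v
  proof -
    have "real smax \<le> c * real smax" using assms(8) by (simp add: mult_le_cancel_right1)
    then have "real smax \<le> real ((\<delta> + 1) * \<tau>)"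
      using assms(9) by (simp add: algebra_simps)
    then have "smax \<le> (\<delta> + 1) * \<tau>" using of_nat_le_iff by blast
    also have "\<dots> \<le> card (?N v) * \<tau>" using card_N[OF v] by (intro mult_le_mono1)
    also have "\<dots> = (\<Sum>u\<in>?N v. \<tau>)" by simp
    also have "\<dots> \<le> (\<Sum>u\<in>?N v. r u)"
      using closed_nbhd_subset[OF v] \<tau> by (intro sum_mono) auto
    finally show ?thesis using smax[OF v] by linarith
  qed

  define q where "q = 1 / c"
  have q: "0 < q" "q < 1" using assms(8) by (auto simp: q_def)
  define y where "y = c * real smax / (real \<delta> + 1)"
  have y: "0 < y" "y \<le> real \<tau>"
    using assms(7-9) by (auto simp: y_def field_simps)
  have y_total: "(real \<delta> + 1) * y = c * real smax"
    by (simp add: y_def add_nonneg_eq_0_iff)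
  \<comment> \<open>The rounding may choose \<open>m + 1\<close> at any vertex, even when \<open>\<theta> = 0\<close>. With \<open>m = \<lceil>y\<rceil> - 1\<close> this stays
    within \<open>r\<close> when \<open>y = \<tau>\<close>; with \<open>m = \<lfloor>y\<rfloor>\<close> it would not.\<close>
  define m where "m = nat (\<lceil>y\<rceil> - 1)"
  define \<theta> where "\<theta> = y - real m"
  have m_eq: "real m = real_of_int \<lceil>y\<rceil> - 1"
    using y(1) by (simp add: m_def)
  have \<theta>: "0 \<le> \<theta>" "\<theta> \<le> 1" unfolding \<theta>_def m_eq by linarith+
  have m_less: "m + 1 \<le> \<tau>"
  proof -
    have "real m < real \<tau>" using m_eq y(2) by linarith
    then show ?thesis by simp
  qed

  \<comment> \<open>The expected value of the majorant of the final weight, as a function of the probabilities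
    with which the vertices are rounded up to \<open>m + 1\<close>.\<close>
  define K where "K = real smax / q ^ smax"
  define F where "F x = (\<Sum>v\<in>?V. real m + x v)
    + K * (\<Sum>v\<in>?V. \<Prod>u\<in>?N v. q ^ m + (- (q ^ m * (1 - q))) * x u)" for x
  have affine: "F (x(i := t)) = (1 - t) * F (x(i := 0)) + t * F (x(i := 1))" for x i t
  proof -
    have "(\<Sum>v\<in>?V. \<Prod>u\<in>?N v. q ^ m + (- (q ^ m * (1 - q))) * (x(i := t)) u)
      = (1 - t) * (\<Sum>v\<in>?V. \<Prod>u\<in>?N v. q ^ m + (- (q ^ m * (1 - q))) * (x(i := 0)) u)
      + t * (\<Sum>v\<in>?V. \<Prod>u\<in>?N v. q ^ m + (- (q ^ m * (1 - q))) * (x(i := 1)) u)"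
      unfolding sum_distrib_left sum.distrib[symmetric]
      by (intro sum.cong refl prod_affine_coordinate finN)
    then show ?thesis
      unfolding F_def sum_affine_coordinate[OF fin, of "real m" x i t] by (simp only: distrib_left mult.left_commute[of K] add_ac)
  qed
  obtain b where b: "\<And>v. v \<in> ?V \<Longrightarrow> b v = 0 \<or> b v = 1" "F b \<le> F (\<lambda>_. \<theta>)"
    using multilinear_rounding[OF fin affine, of "\<lambda>_. \<theta>"] \<theta> by blast
  define f where "f v = (if b v = 1 then m + 1 else m)" for v
  have f_real: "real (f v) = real m + b v" if "v \<in> ?V" for v
    using b(1)[OF that] by (auto simp: f_def)
  have f_power: "q ^ f v = q ^ m + (- (q ^ m * (1 - q))) * b v" if "v \<in> ?V" for v
    using b(1)[OF that] by (auto simp: f_def algebra_simps)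
  have f_r: "r_function G r f"
    unfolding r_function_def
  proof
    fix v assume "v \<in> ?V"
    then show "f v \<le> r v" using m_less \<tau>[of v] by (simp add: f_def)
  qed

  have "real (rs_domination_number G r s)
      \<le> real (weight G f + (\<Sum>v\<in>?V. s v - (\<Sum>u\<in>?N v. f u)))"
    using rs_domination_number_le_weight_plus_deficits[OF feasible f_r] of_nat_le_iff by blast
  also have "\<dots> = (\<Sum>v\<in>?V. real m + b v) + (\<Sum>v\<in>?V. real (s v - (\<Sum>u\<in>?N v. f u)))"
    using f_real by (simp add: weight_def)
  also have "\<dots> < (\<Sum>v\<in>?V. real m + b v) + (\<Sum>v\<in>?V. K * q ^ (\<Sum>u\<in>?N v. f u))"
  proof (intro add_strict_left_mono sum_strict_mono fin assms(2))
    fix v assume "v \<in> ?V"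
    then have "real (s v - (\<Sum>u\<in>?N v. f u)) \<le> real (smax - (\<Sum>u\<in>?N v. f u))"
      using smax by (simp add: diff_le_mono)
    also have "\<dots> < K * q ^ (\<Sum>u\<in>?N v. f u)"
      unfolding K_def by (rule deficit_less_power[OF q assms(7)])
    finally show "real (s v - (\<Sum>u\<in>?N v. f u)) < K * q ^ (\<Sum>u\<in>?N v. f u)" .
  qed
  also have "\<dots> = F b"
  proof -
    have "q ^ (\<Sum>u\<in>?N v. f u) = (\<Prod>u\<in>?N v. q ^ m + (- (q ^ m * (1 - q))) * b u)"
      if "v \<in> ?V" for v
      unfolding power_sum using closed_nbhd_subset[OF that] f_power by (intro prod.cong) auto
    then show ?thesis by (simp add: F_def sum_distrib_left)
  qed
  also have "\<dots> \<le> F (\<lambda>_. \<theta>)" by (rule b(2))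
  also have "\<dots> \<le> real n * y + K * (\<Sum>v\<in>?V. exp (- real smax * (c - 1)))"
  proof -
    have "(\<Prod>u\<in>?N v. q ^ m + (- (q ^ m * (1 - q))) * \<theta>) \<le> exp (- real smax * (c - 1))"
      if v: "v \<in> ?V" for v
    proof -
      let ?a = "q ^ m * (1 - (1 - q) * \<theta>)"
      have "(1 - q) * \<theta> \<le> 1 * 1" using \<theta> q by (intro mult_mono) auto
      then have a0: "0 \<le> ?a" using q by simp
      have a: "?a \<le> exp (- (1 - q) * y)"
        using rounded_power_le_exp[of q m \<theta>] q by (simp add: \<theta>_def)
      have "(\<Prod>u\<in>?N v. q ^ m + (- (q ^ m * (1 - q))) * \<theta>) = ?a ^ card (?N v)"
        by (simp add: algebra_simps)
      also have "\<dots> \<le> exp (- (1 - q) * y) ^ card (?N v)"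
        using a a0 by (rule power_mono)
      also have "\<dots> \<le> exp (- (1 - q) * y) ^ (\<delta> + 1)"
        using card_N[OF v] q y by (intro power_decreasing) (auto simp: mult_nonpos_nonneg)
      also have "\<dots> = exp (- ((1 - q) * ((real \<delta> + 1) * y)))"
        unfolding exp_of_nat_mult[symmetric] by (simp add: algebra_simps)
      also have "(1 - q) * ((real \<delta> + 1) * y) = real smax * (c - 1)"
        unfolding y_total using assms(8) by (simp add: q_def field_simps)
      finally show ?thesis by simp
    qed
    then have "(\<Sum>v\<in>?V. \<Prod>u\<in>?N v. q ^ m + (- (q ^ m * (1 - q))) * \<theta>)
        \<le> (\<Sum>v\<in>?V. exp (- real smax * (c - 1)))"
      by (rule sum_mono)
    moreover have "0 \<le> K" using q by (simp add: K_def)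
    moreover have "(\<Sum>v\<in>?V. real m + \<theta>) = real n * y" by (simp add: \<theta>_def assms(3))
    ultimately show ?thesis unfolding F_def by (simp add: mult_left_mono)
  qed
  also have "\<dots> = real n * y + real smax * real n * (c ^ smax * exp (- real smax * (c - 1)))"
    using assms(8) by (simp add: K_def q_def assms(3) field_simps)
  also have "\<dots> \<le> real n * y
      + real smax * real n * (1 / exp (1 / 2 * real smax * (c + 1 / c - 2)))"
    by (intro add_left_mono mult_left_mono power_times_exp_le assms(8)) auto
  also have "\<dots> = (c / (real \<delta> + 1) + 1 / exp (1 / 2 * real smax * (c + 1 / c - 2)))
      * real smax * real n"
    by (simp add: y_def algebra_simps)
  finally show ?thesis .
qed

end
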